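(* Let $X$ be a Tychonoff space. (i) If $X$ is a $k_{\mathbb{R}}$-space, then $X$ is weakly open-compact attainable. (ii) If $X$ is an $s_{\mathbb{R}}$-space, then $X$ is $\kappa$-sequential. (iii) If $X$ is a $k'$-space, then $X$ is open-compact attainable. In particular, every locally compact space is open-compact attainable. (iv) If $X$ is $\kappa$-Fréchet--Urysohn, then $X$ is open-compact attainable. (v) If $X$ is open-compact attainable, then $X$ is an Ascoli space.
   Context: All topological spaces are assumed to be Tychonoff. $C_k(X)$ denotes the space of all continuous real-valued functions on $X$ with the compact-open topology. A space $X$ is called: - a $k_{\mathbb{R}}$-space if every function $f:X\to\mathbb{R}$ whose restriction to each compact subset of $X$ is continuous is itself continuous; - an $s_{\mathbb{R}}$-space if every function $f:X\to\mathbb{R}$ whose restriction to each convergent sequence (with its limit) is continuous is itself continuous; - a $k'$-space if for each $A\subseteq X$ and every $a\in\overline{A}$ there is a compact $K\subseteq X$ with $a\in\overline{K\cap A}$; - $\kappa$-Fréchet--Urysohn if for every open $U\subseteq X$ and every $x\in\overline{U}$ there is a sequence in $U$ converging to $x$; - open-compact attainable if for every open $W\subseteq X$ and every $z\in\overline{W}$ there is a compact $K\subseteq X$ with $z\in K\cap\overline{K\cap W}$; - weakly open-compact attainable if for every non-closed open $W\subseteq X$ there are $z\in\overline{W}\setminus W$ and a compact $K\subseteq X$ with $z\in K\cap\overline{K\cap W}$; - $\kappa$-sequential if for every non-closed open $W\subseteq X$ there are $z\in\overline{W}\setminus W$ and a sequence in $W$ converging to $z$; - Ascoli if every compact subset $\mathcal{K}$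 of $C_k(X)$ is evenly continuous, i.e. the map $X\times\mathcal{K}\to\mathbb{R}$, $(x,f)\mapsto f(x)$, is continuous. *)

theory Defs
  imports "HOL-Analysis.Analysis"
begin

text \<open>Spaces are abstract topologies, so the points of \<open>X\<close> are the elements of \<open>topspace X\<close>.\<close>

text \<open>Functions on \<open>X\<close> are made extensional, so that two elements are equal iff they agree
  on \<open>topspace X\<close>.\<close>

definition continuous_real_functions :: "'a topology \<Rightarrow> ('a \<Rightarrow> real) set" where
  "continuous_real_functions X =
     {f. f \<in> extensional (topspace X) \<and> continuous_map X euclideanreal f}"

text \<open>The topology generated by the subbasic sets \<open>[K, V]\<close> of functions mapping the compact
  set \<open>K\<close> into the open set \<open>V\<close>; the choice \<open>K = {}\<close> gives the whole carrier.\<close>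

definition compact_open_topology :: "'a topology \<Rightarrow> ('a \<Rightarrow> real) topology" where
  "compact_open_topology X =
     topology_generated_by
       {{f \<in> continuous_real_functions X. f ` K \<subseteq> V} | K V. compactin X K \<and> open V}"

lemma topspace_compact_open_topology [simp]:
  "topspace (compact_open_topology X) = continuous_real_functions X"
proof -
  have "continuous_real_functions X
      \<in> {{f \<in> continuous_real_functions X. f ` K \<subseteq> V} | K V. compactin X K \<and> open V}"
    by (rule CollectI, rule exI[of _ "{}"], rule exI[of _ UNIV]) auto
  then show ?thesis
    unfolding compact_open_topology_def topology_generated_by_topspace by blast
qed

definition kR_space :: "'a topology \<Rightarrow> bool" where
  "kR_space X \<longleftrightarrow>
     (\<forall>f :: 'a \<Rightarrow> real.
        (\<forall>K. compactin X K \<longrightarrow> continuous_map (subtopology X K) euclideanreal f)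
        \<longrightarrow> continuous_map X euclideanreal f)"

text \<open>The predicate \<open>limitin\<close> only constrains a tail of the sequence, hence the separate
  condition that all terms are points of the space.\<close>

definition sR_space :: "'a topology \<Rightarrow> bool" where
  "sR_space X \<longleftrightarrow>
     (\<forall>f :: 'a \<Rightarrow> real.
        (\<forall>(s :: nat \<Rightarrow> 'a) x. range s \<subseteq> topspace X \<and> limitin X s x sequentially
           \<longrightarrow> continuous_map (subtopology X (insert x (range s))) euclideanreal f)
        \<longrightarrow> continuous_map X euclideanreal f)"

definition k_prime_space :: "'a topology \<Rightarrow> bool" where
  "k_prime_space X \<longleftrightarrow>
     (\<forall>A a. A \<subseteq> topspace X \<and> a \<in> X closure_of A
        \<longrightarrow> (\<exists>K. compactin X K \<and> a \<in> X closure_of (K \<inter> A)))"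

definition kappa_Frechet_Urysohn :: "'a topology \<Rightarrow> bool" where
  "kappa_Frechet_Urysohn X \<longleftrightarrow>
     (\<forall>U x. openin X U \<and> x \<in> X closure_of U
        \<longrightarrow> (\<exists>s :: nat \<Rightarrow> 'a. range s \<subseteq> U \<and> limitin X s x sequentially))"

definition open_compact_attainable :: "'a topology \<Rightarrow> bool" where
  "open_compact_attainable X \<longleftrightarrow>
     (\<forall>W z. openin X W \<and> z \<in> X closure_of W
        \<longrightarrow> (\<exists>K. compactin X K \<and> z \<in> K \<inter> X closure_of (K \<inter> W)))"

definition weakly_open_compact_attainable :: "'a topology \<Rightarrow> bool" where
  "weakly_open_compact_attainable X \<longleftrightarrow>
     (\<forall>W. openin X W \<and> \<not> closedin X W
        \<longrightarrow> (\<exists>z \<in> X closure_of W - W.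
               \<exists>K. compactin X K \<and> z \<in> K \<inter> X closure_of (K \<inter> W)))"

definition kappa_sequential :: "'a topology \<Rightarrow> bool" where
  "kappa_sequential X \<longleftrightarrow>
     (\<forall>W. openin X W \<and> \<not> closedin X W
        \<longrightarrow> (\<exists>z \<in> X closure_of W - W.
               \<exists>s :: nat \<Rightarrow> 'a. range s \<subseteq> W \<and> limitin X s z sequentially))"

definition evenly_continuous :: "'a topology \<Rightarrow> ('a \<Rightarrow> real) set \<Rightarrow> bool" where
  "evenly_continuous X \<K> \<longleftrightarrow>
     continuous_map (prod_topology X (subtopology (compact_open_topology X) \<K>))
       euclideanreal (\<lambda>(x, f). f x)"

definition Ascoli_space :: "'a topology \<Rightarrow> bool" where
  "Ascoli_space X \<longleftrightarrow>
     (\<forall>\<K>. compactin (compact_open_topology X) \<K> \<longrightarrow> evenly_continuous X \<K>)"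

end

theory Submission
  imports Defs
begin

text \<open>For (i) and (ii), an open set witnessing the failure of the conclusion would have relatively
  clopen trace on every compact set (convergent sequence), so its indicator function would be
  continuous on all of them, hence continuous, and the set would be closed.

  For (v), compactness of \<open>\<K>\<close> makes its restriction to a compact set \<open>K\<close> equicontinuous at
  the points of \<open>K\<close>. If evaluation were discontinuous at \<open>(z, f)\<close>, the open set of points at which
  some \<open>g \<in> \<K>\<close> with \<open>g z\<close> near \<open>f z\<close> takes a value far from \<open>f z\<close> would have \<open>z\<close> in its closure.
  Attaining \<open>z\<close> from a compact \<open>K\<close> then contradicts equicontinuity on \<open>K\<close>.\<close>

section \<open>Indicator functions of open sets\<close>

text \<open>By \<open>cl\<close>, the trace of \<open>W\<close> on \<open>S\<close> is also the
  trace of a closed set, so it is clopen in the subspace. Preimages under the indicator are built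
  from this trace and its complement.\<close>

lemma continuous_map_indicator_subtopology:
  assumes W: "openin X W" and cl: "S \<inter> X closure_of (S \<inter> W) \<subseteq> W"
  shows "continuous_map (subtopology X S) euclideanreal (indicator W)"
proof -
  let ?Y = "subtopology X S"
  have eq: "topspace ?Y \<inter> W = topspace ?Y \<inter> X closure_of (S \<inter> W)"
    using cl openin_subset[OF W] closure_of_subset[of "S \<inter> W" X] by auto
  have op: "openin ?Y (topspace ?Y \<inter> W)"
    using W openin_subset[OF W] by (auto simp: openin_subtopology Int_ac)
  have cld: "closedin ?Y (topspace ?Y \<inter> W)"
    unfolding eq closedin_subtopology
    by (intro exI[of _ "X closure_of (S \<inter> W)"]) (use closure_of_subset_topspace in \<open>fastforce\<close>)
  have "openin ?Y {x \<in> topspace ?Y. indicator W x \<in> U}" for U :: "real set"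
  proof -
    have "{x \<in> topspace ?Y. indicator W x \<in> U} =
        (if 1 \<in> U then topspace ?Y \<inter> W else {}) \<union>
        (if 0 \<in> U then topspace ?Y - (topspace ?Y \<inter> W) else {})"
      by (auto simp: indicator_def)
    moreover have "openin ?Y (topspace ?Y - (topspace ?Y \<inter> W))"
      using cld by blast
    ultimately show ?thesis
      using op by (auto intro!: openin_Un simp del: topspace_subtopology)
  qed
  then show ?thesis
    by (auto simp: continuous_map_def)
qed

lemma continuous_map_indicator_imp_closedin:
  assumes "openin X W" and "continuous_map X euclideanreal (indicator W)"
  shows "closedin X W"
proof -
  have "closedin X {x \<in> topspace X. indicator W x \<in> {1 :: real}}"
    using assms(2) by (rule closedin_continuous_map_preimage) simp
  moreover have "{x \<in> topspace X. indicator W x \<in> {1 :: real}} = W"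
    using openin_subset[OF assms(1)] by (auto simp: indicator_def)
  ultimately show ?thesis by simp
qed

section \<open>Convergent sequences\<close>

lemma compactin_insert_limit_range:
  fixes s :: "nat \<Rightarrow> 'a"
  assumes lim: "limitin X s x sequentially" and s: "range s \<subseteq> topspace X"
  shows "compactin X (insert x (range s))"
  unfolding compactin_def
proof (intro conjI allI impI)
  show "insert x (range s) \<subseteq> topspace X"
    using limitin_topspace[OF lim] s by auto
next
  fix \<U> assume \<U>: "(\<forall>U\<in>\<U>. openin X U) \<and> insert x (range s) \<subseteq> \<Union>\<U>"
  then obtain U where U: "U \<in> \<U>" "x \<in> U" by auto
  then obtain N where N: "\<And>n. N \<le> n \<Longrightarrow> s n \<in> U"
    using lim \<U> unfolding limitin_sequentially by blast
  have "\<forall>n. \<exists>V\<in>\<U>. s n \<in> V" using \<U> by blast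
  then obtain V where V: "\<And>n. V n \<in> \<U>" "\<And>n. s n \<in> V n" by metis
  have "insert x (range s) \<subseteq> \<Union>(insert U (V ` {..<N}))"
    using U N V by auto (metis lessThan_iff not_less)
  then show "\<exists>\<F>. finite \<F> \<and> \<F> \<subseteq> \<U> \<and> insert x (range s) \<subseteq> \<Union>\<F>"
    using U V by (intro exI[of _ "insert U (V ` {..<N})"]) auto
qed

text \<open>In a Hausdorff space a convergent sequence accumulates only at its limit. So
  \<open>z\<close> must be \<open>x\<close>, and the sequence must visit \<open>W\<close> infinitely
  often; enumerating those visits gives \<open>r\<close>.\<close>

lemma limitin_subsequence_if_closure:
  fixes s :: "nat \<Rightarrow> 'a"
  assumes H: "Hausdorff_space X" and lim: "limitin X s x sequentially"
    and s: "range s \<subseteq> topspace X"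
    and z: "z \<in> X closure_of (insert x (range s) \<inter> W)" "z \<notin> W"
  shows "\<exists>r. range (s \<circ> r) \<subseteq> W \<and> limitin X (s \<circ> r) z sequentially"
proof -
  let ?S = "insert x (range s)"
  have fin_cl: "X closure_of A = A" if "finite A" "A \<subseteq> ?S" for A
    using that s limitin_topspace[OF lim] closedin_Hausdorff_finite[OF H]
    by (intro closure_of_closedin) (metis insert_subset subset_trans)
  have zX: "z \<in> topspace X" using z(1) by (meson in_closure_of)
  have "z = x"
  proof (rule ccontr)
    assume "z \<noteq> x"
    then obtain U V where UV: "openin X U" "openin X V" "z \<in> U" "x \<in> V" "disjnt U V"
      using H zX limitin_topspace[OF lim] unfolding Hausdorff_space_def by metis
    obtain N where "\<And>n. N \<le> n \<Longrightarrow> s n \<in> V"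
      using lim UV unfolding limitin_sequentially by blast
    \<comment> \<open>\<open>U\<close> misses \<open>V\<close>, hence misses \<open>x\<close> and
      all terms from \<open>N\<close> on. The finite remainder is closed, which would put
      \<open>z\<close> into \<open>W\<close>.\<close>
    then have "U \<inter> (?S \<inter> W) \<subseteq> s ` {..<N}"
      using UV by (auto simp: disjnt_iff not_less) (metis imageI lessThan_iff not_le)
    then have "finite (U \<inter> (?S \<inter> W))" by (rule finite_subset) simp
    moreover have "z \<in> X closure_of (U \<inter> (?S \<inter> W))"
      using openin_Int_closure_of_subset[OF UV(1)] UV(3) z(1) by blast
    ultimately show False using fin_cl[of "U \<inter> (?S \<inter> W)"] z(2) by blast
  qed
  have "infinite {n. s n \<in> W}"
  proof
    assume "finite {n. s n \<in> W}"
    moreover have "?S \<inter> W \<subseteq> s ` {n. s n \<in> W}"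
      using z(2) \<open>z = x\<close> by auto
    ultimately have "finite (?S \<inter> W)" by (meson finite_imageI finite_subset)
    then show False using fin_cl[of "?S \<inter> W"] z by auto
  qed
  then obtain r :: "nat \<Rightarrow> nat" where r: "strict_mono r" "\<And>n. r n \<in> {n. s n \<in> W}"
    using infinite_enumerate by blast
  then show ?thesis
    using limitin_subsequence[OF r(1) lim] \<open>z = x\<close> by (intro exI[of _ r]) auto
qed

section \<open>Attainability and sequential properties\<close>

lemma kR_space_imp_weakly_open_compact_attainable:
  assumes kR: "kR_space X"
  shows "weakly_open_compact_attainable X"
  unfolding weakly_open_compact_attainable_def
proof (intro allI impI, rule ccontr)
  fix W
  assume W: "openin X W \<and> \<not> closedin X W"
    and neg: "\<not> (\<exists>z \<in> X closure_of W - W.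
               \<exists>K. compactin X K \<and> z \<in> K \<inter> X closure_of (K \<inter> W))"
  have "continuous_map (subtopology X K) euclideanreal (indicator W)" if "compactin X K" for K
  proof (rule continuous_map_indicator_subtopology)
    show "K \<inter> X closure_of (K \<inter> W) \<subseteq> W"
      using neg that closure_of_mono[of "K \<inter> W" W X] by blast
  qed (use W in blast)
  then have "continuous_map X euclideanreal (indicator W)"
    using kR unfolding kR_space_def by blast
  with W show False using continuous_map_indicator_imp_closedin by blast
qed

lemma sR_space_imp_kappa_sequential:
  assumes H: "Hausdorff_space X" and sR: "sR_space X"
  shows "kappa_sequential X"
  unfolding kappa_sequential_def
proof (intro allI impI, rule ccontr)
  fix W
  assume W: "openin X W \<and> \<not> closedin X W"
    and neg: "\<not> (\<exists>z \<in> X closure_of W - W.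
               \<exists>s :: nat \<Rightarrow> 'a. range s \<subseteq> W \<and> limitin X s z sequentially)"
  have "continuous_map (subtopology X (insert x (range s))) euclideanreal (indicator W)"
    if s: "range s \<subseteq> topspace X" "limitin X s x sequentially" for s :: "nat \<Rightarrow> 'a" and x
  proof (rule continuous_map_indicator_subtopology)
    \<comment> \<open>A point of this closure outside \<open>W\<close> would be the limit of a
      subsequence lying in \<open>W\<close>, contradicting \<open>neg\<close>.\<close>
    show "insert x (range s) \<inter> X closure_of (insert x (range s) \<inter> W) \<subseteq> W"
      using limitin_subsequence_if_closure[OF H s(2) s(1)]
        closure_of_mono[of "insert x (range s) \<inter> W" W X] neg
      by blast
  qed (use W in blast)
  then have "continuous_map X euclideanreal (indicator W)"
    using sR unfolding sR_space_def by blast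
  with W show False using continuous_map_indicator_imp_closedin by blast
qed

text \<open>What has to be added to the k'-property is \<open>z \<in> K\<close>: compact sets are
  closed in a Hausdorff space, so the closure of \<open>K \<inter> W\<close> stays inside
  \<open>K\<close>.\<close>

lemma k_prime_space_imp_open_compact_attainable:
  assumes H: "Hausdorff_space X" and k': "k_prime_space X"
  shows "open_compact_attainable X"
  unfolding open_compact_attainable_def
proof (intro allI impI)
  fix W z assume "openin X W \<and> z \<in> X closure_of W"
  then obtain K where K: "compactin X K" "z \<in> X closure_of (K \<inter> W)"
    using k' openin_subset unfolding k_prime_space_def by blast
  then have "X closure_of (K \<inter> W) \<subseteq> K"
    using compactin_imp_closedin[OF H K(1)] by (simp add: closure_of_minimal)
  with K show "\<exists>K. compactin X K \<and> z \<in> K \<inter> X closure_of (K \<inter> W)" by blast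
qed

text \<open>Closure is a local notion, so any compact neighbourhood of \<open>a\<close> serves as
  \<open>K\<close>, whatever \<open>A\<close> is.\<close>

lemma locally_compact_space_imp_k_prime_space:
  assumes "locally_compact_space X"
  shows "k_prime_space X"
  unfolding k_prime_space_def
proof (intro allI impI)
  fix A a assume a: "A \<subseteq> topspace X \<and> a \<in> X closure_of A"
  then have "a \<in> topspace X" by (meson in_closure_of)
  then obtain U K where UK: "openin X U" "compactin X K" "a \<in> U" "U \<subseteq> K"
    using assms unfolding locally_compact_space_def by blast
  then have "a \<in> X closure_of (U \<inter> A)"
    using a openin_Int_closure_of_subset[OF UK(1)] by blast
  then have "a \<in> X closure_of (K \<inter> A)"
    using UK(4) closure_of_mono[of "U \<inter> A" "K \<inter> A" X] by blast
  with UK(2) show "\<exists>K. compactin X K \<and> a \<in> X closure_of (K \<inter> A)" by blast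
qed

text \<open>The compact set is a sequence in \<open>W\<close> converging to \<open>z\<close>,
  together with \<open>z\<close>.\<close>

lemma kappa_Frechet_Urysohn_imp_open_compact_attainable:
  assumes "kappa_Frechet_Urysohn X"
  shows "open_compact_attainable X"
  unfolding open_compact_attainable_def
proof (intro allI impI)
  fix W z assume Wz: "openin X W \<and> z \<in> X closure_of W"
  then obtain s :: "nat \<Rightarrow> 'a" where s: "range s \<subseteq> W" "limitin X s z sequentially"
    using assms unfolding kappa_Frechet_Urysohn_def by blast
  have "z \<in> X closure_of (insert z (range s) \<inter> W)"
    unfolding in_closure_of
  proof (intro conjI allI impI)
    show "z \<in> topspace X" using Wz by (meson in_closure_of)
    fix T assume "z \<in> T \<and> openin X T"
    then obtain N where "\<And>n. N \<le> n \<Longrightarrow> s n \<in> T"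
      using s(2) unfolding limitin_sequentially by blast
    then show "\<exists>y. y \<in> insert z (range s) \<inter> W \<and> y \<in> T"
      using s(1) by (intro exI[of _ "s N"]) auto
  qed
  moreover have "compactin X (insert z (range s))"
    using compactin_insert_limit_range[OF s(2)] s(1) openin_subset Wz by blast
  ultimately show "\<exists>K. compactin X K \<and> z \<in> K \<inter> X closure_of (K \<inter> W)" by blast
qed

section \<open>The compact-open topology and the Ascoli property\<close>

lemma openin_compact_open_topology_subbasic:
  assumes "compactin X K" "open V"
  shows "openin (compact_open_topology X) {f \<in> continuous_real_functions X. f ` K \<subseteq> V}"
  unfolding compact_open_topology_def openin_topology_generated_by_iff
  using assms by (blast intro: generate_topology_on.Basis)

text \<open>Each \<open>g\<close> in \<open>\<K>\<close> has the compact-open neighbourhood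
  \<open>N g\<close>, whose members stay within \<open>e/2\<close> of \<open>g z\<close> on the part
  of \<open>K\<close> where \<open>g\<close> stays within \<open>e/4\<close> of it. Finitely many of
  these cover \<open>\<K>\<close>, so only finitely many functions restrict the choice of
  \<open>O'\<close>.\<close>

lemma compactin_compact_open_topology_imp_equicontinuous:
  assumes \<K>: "compactin (compact_open_topology X) \<K>" and K: "compactin X K"
    and z: "z \<in> K" and e: "e > 0"
  shows "\<exists>O'. openin X O' \<and> z \<in> O' \<and> (\<forall>g\<in>\<K>. \<forall>x\<in>O' \<inter> K. \<bar>g x - g z\<bar> < e)"
proof -
  have zX: "z \<in> topspace X" using K z compactin_subset_topspace by blast
  have \<K>_sub: "\<K> \<subseteq> continuous_real_functions X"
    using compactin_subset_topspace[OF \<K>] by simp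
  \<comment> \<open>The interval is closed so that \<open>C g \<inter> K\<close> is compact; the
    larger open interval in \<open>N g\<close> makes \<open>N g\<close> an open set containing
    \<open>g\<close>.\<close>
  define C where "C g = {x \<in> topspace X. g x \<in> {g z - e/4..g z + e/4}}" for g :: "'a \<Rightarrow> real"
  define N where "N g = {h \<in> continuous_real_functions X. h ` (C g \<inter> K) \<subseteq> {g z - e/2<..<g z + e/2}}"
    for g :: "'a \<Rightarrow> real"
  have "compactin X (C g \<inter> K)" if "g \<in> \<K>" for g
  proof (rule closed_Int_compactin[OF _ K])
    show "closedin X (C g)"
      unfolding C_def
      by (rule closedin_continuous_map_preimage[where Y = euclideanreal])
        (use that \<K>_sub in \<open>auto simp: continuous_real_functions_def\<close>)
  qed
  then have "\<forall>B \<in> N ` \<K>. openin (compact_open_topology X) B"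
    unfolding N_def by (auto intro!: openin_compact_open_topology_subbasic)
  moreover have "\<K> \<subseteq> \<Union>(N ` \<K>)"
  proof
    fix g assume "g \<in> \<K>"
    then have "g \<in> N g" using \<K>_sub e by (auto simp: N_def C_def)
    with \<open>g \<in> \<K>\<close> show "g \<in> \<Union>(N ` \<K>)" by blast
  qed
  ultimately have "\<exists>\<F>. finite \<F> \<and> \<F> \<subseteq> N ` \<K> \<and> \<K> \<subseteq> \<Union>\<F>"
    using \<K> unfolding compactin_def by meson
  then obtain F where F: "finite F" "F \<subseteq> \<K>" "\<K> \<subseteq> \<Union>(N ` F)"
    by (metis finite_subset_image)
  \<comment> \<open>Intersecting with \<open>topspace X\<close> keeps \<open>O'\<close> a subset of
    the space when \<open>F\<close> is empty.\<close>
  define O' where "O' = topspace X \<inter> (\<Inter>g\<in>F. {x \<in> topspace X. g x \<in> {g z - e/4<..<g z + e/4}})"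
  have "openin X {x \<in> topspace X. g x \<in> {g z - e/4<..<g z + e/4}}" if "g \<in> F" for g
    by (rule openin_continuous_map_preimage[where Y = euclideanreal])
      (use that F \<K>_sub in \<open>auto simp: continuous_real_functions_def\<close>)
  then have "openin X O'"
    unfolding O'_def using F(1) by (intro openin_Int_Inter) auto
  moreover have "z \<in> O'" using zX e by (auto simp: O'_def)
  moreover have "\<bar>h x - h z\<bar> < e" if h: "h \<in> \<K>" and x: "x \<in> O' \<inter> K" for h x
  proof -
    obtain g where g: "g \<in> F" "h \<in> N g" using F(3) h by blast
    \<comment> \<open>Since \<open>z\<close> lies in \<open>K\<close> too, both \<open>h x\<close>
      and \<open>h z\<close> are within \<open>e/2\<close> of \<open>g z\<close>, hence within
      \<open>e\<close> of each other.\<close>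
    have "x \<in> C g \<inter> K" "z \<in> C g \<inter> K"
      using x g z zX e by (auto simp: O'_def C_def less_imp_le)
    then have "h x \<in> {g z - e/2<..<g z + e/2}" "h z \<in> {g z - e/2<..<g z + e/2}"
      using g(2) unfolding N_def by blast+
    then show ?thesis unfolding greaterThanLessThan_iff by argo
  qed
  ultimately show ?thesis by blast
qed

lemma open_compact_attainable_imp_Ascoli_space:
  assumes "open_compact_attainable X"
  shows "Ascoli_space X"
  unfolding Ascoli_space_def evenly_continuous_def
proof (intro allI impI)
  fix \<K> assume \<K>: "compactin (compact_open_topology X) \<K>"
  let ?Y = "subtopology (compact_open_topology X) \<K>"
  have \<K>_sub: "\<K> \<subseteq> continuous_real_functions X"
    using compactin_subset_topspace[OF \<K>] by simp
  have nbhd: "\<exists>U. openin (prod_topology X ?Y) U \<and> (z, f) \<in> U \<and> (\<forall>(x, g)\<in>U. \<bar>f z - g x\<bar> < e)"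
    if z: "z \<in> topspace X" and f: "f \<in> \<K>" and e: "e > 0" for z f e
  proof -
    \<comment> \<open>A neighbourhood of \<open>f\<close> in \<open>\<K>\<close>, subbasic for the
      compact set \<open>{z}\<close>. For \<open>g\<close> in \<open>V\<close>, a value
      \<open>g x\<close> more than \<open>e/2\<close> away from \<open>f z\<close> is more than
      \<open>e/4\<close> away from \<open>g z\<close>, which is what equicontinuity with
      \<open>e/4\<close> excludes.\<close>
    define V where "V = \<K> \<inter> {g \<in> continuous_real_functions X. g ` {z} \<subseteq> {f z - e/4<..<f z + e/4}}"
    define W where "W = (\<Union>g\<in>V. {x \<in> topspace X. g x \<in> - {f z - e/2..f z + e/2}})"
    have "openin ?Y V"
      unfolding V_def using z
      by (intro openin_subtopology_Int2 openin_compact_open_topology_subbasic) auto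
    have "openin X {x \<in> topspace X. g x \<in> - {f z - e/2..f z + e/2}}" if "g \<in> V" for g
      by (rule openin_continuous_map_preimage[where Y = euclideanreal])
        (use that in \<open>auto simp: V_def continuous_real_functions_def\<close>)
    then have W: "openin X W" unfolding W_def by blast
    have "z \<notin> X closure_of W"
    proof
      assume "z \<in> X closure_of W"
      then obtain K where K: "compactin X K" "z \<in> K" "z \<in> X closure_of (K \<inter> W)"
        using assms W unfolding open_compact_attainable_def by blast
      obtain O' where O': "openin X O'" "z \<in> O'" "\<forall>g\<in>\<K>. \<forall>x\<in>O' \<inter> K. \<bar>g x - g z\<bar> < e/4"
        using compactin_compact_open_topology_imp_equicontinuous[OF \<K> K(1,2), of "e/4"] e by auto
      obtain x where x: "x \<in> K" "x \<in> W" "x \<in> O'"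
        using K(3) O'(1,2) unfolding in_closure_of by blast
      then obtain g where g: "g \<in> V" "g x \<notin> {f z - e/2..f z + e/2}"
        unfolding W_def by blast
      have "\<bar>g x - g z\<bar> < e/4" "g z \<in> {f z - e/4<..<f z + e/4}"
        using O'(3) x g(1) by (auto simp: V_def)
      with g(2) show False
        unfolding greaterThanLessThan_iff atLeastAtMost_iff by argo
    qed
    \<comment> \<open>Off the closure of \<open>W\<close>, every \<open>g\<close> in
      \<open>V\<close> takes values within \<open>e/2\<close> of \<open>f z\<close>.\<close>
    let ?U = "(topspace X - X closure_of W) \<times> V"
    have "openin (prod_topology X ?Y) ?U"
      using \<open>openin ?Y V\<close> by (auto simp: openin_prod_Times_iff)
    moreover have "(z, f) \<in> ?U"
      using z f e \<open>z \<notin> X closure_of W\<close> \<K>_sub by (auto simp: V_def)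
    moreover have "\<bar>f z - g x\<bar> < e" if xg: "(x, g) \<in> ?U" for x g
    proof -
      have "x \<notin> W" using xg closure_of_subset[OF openin_subset[OF W]] by blast
      then have "g x \<in> {f z - e/2..f z + e/2}" using xg unfolding W_def by blast
      with e show ?thesis unfolding atLeastAtMost_iff by argo
    qed
    ultimately show ?thesis by (intro exI[of _ ?U]) blast
  qed
  \<comment> \<open>Viewing the real line as a metric space turns continuity into the epsilon
    condition \<open>nbhd\<close>.\<close>
  have "continuous_map (prod_topology X ?Y) Met_TC.mtopology (\<lambda>(x, f). f x :: real)"
    unfolding Met_TC.continuous_map_to_metric
  proof (intro ballI allI impI)
    fix p and e :: real assume "p \<in> topspace (prod_topology X ?Y)" "e > 0"
    then show "\<exists>U. openin (prod_topology X ?Y) U \<and> p \<in> U \<and>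
        (\<forall>q\<in>U. (case q of (x, f) \<Rightarrow> f x) \<in> Met_TC.mball (case p of (x, f) \<Rightarrow> f x) e)"
      using nbhd[of "fst p" "snd p" e] by (force simp: dist_real_def split_beta)
  qed
  then show "continuous_map (prod_topology X ?Y) euclideanreal (\<lambda>(x, f). f x)"
    by simp
qed

theorem proposition2p6:
  fixes X :: "'a topology"
  assumes "completely_regular_space X" and "Hausdorff_space X"
  shows "(kR_space X \<longrightarrow> weakly_open_compact_attainable X) \<and>
         (sR_space X \<longrightarrow> kappa_sequential X) \<and>
         (k_prime_space X \<longrightarrow> open_compact_attainable X) \<and>
         (locally_compact_space X \<longrightarrow> open_compact_attainable X) \<and>
         (kappa_Frechet_Urysohn X \<longrightarrow> open_compact_attainable X) \<and>
         (open_compact_attainable X \<longrightarrow> Ascoli_space X)"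
  \<comment> \<open>The locally compact case passes through \<open>k_prime_space\<close>.\<close>
  using assms(2) kR_space_imp_weakly_open_compact_attainable sR_space_imp_kappa_sequential
    k_prime_space_imp_open_compact_attainable locally_compact_space_imp_k_prime_space
    kappa_Frechet_Urysohn_imp_open_compact_attainable open_compact_attainable_imp_Ascoli_space
  by blast

end
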